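(* Let $a\in(0,1)$ and let $(L(t))_{t\in\mathbb{N}}$ be the Markov chain on $\{1,2,\dots\}$ with $L(0)=1$ and, for $t\ge 0$, $L(t+1)=L(t)+1$ with probability $a^{L(t)}$ and $L(t+1)=L(t)$ with probability $1-a^{L(t)}$. Let $H=\sum_{k=0}^{+\infty}a^kE_k$ where $(E_k)_{k\ge0}$ are independent exponential random variables with parameter $1$, and define the random function \[ F(x)=\log_{1/a}\left(\frac{1}{aH}\right)-\left\{x-\log_{1/a}(H)\right\},\qquad x\in\mathbb{R}, \] where $\{z\}=z-\lfloor z\rfloor$ is the fractional part. Then, asymptotically as $t\to+\infty$, the distribution of $L(t)-\log_{1/a}(t)$ is equivalent to the distribution of $F(\log_{1/a}(t))$. The random function $x\mapsto F(x)$ is periodic with period $1$.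
   Context: This is the counter of a station in a completely congested Ethernet network (case $a=1/2$). *)

theory Defs
  imports "HOL-Probability.Probability" "HOL-Library.Periodic_Fun"
begin

text \<open>Conditioning is only required on pasts of positive probability.\<close>

definition markov_chain ::
  "'w measure \<Rightarrow> 's set \<Rightarrow> ('s \<Rightarrow> 's pmf) \<Rightarrow> (nat \<Rightarrow> 'w \<Rightarrow> 's) \<Rightarrow> bool" where
  "markov_chain M S K X \<longleftrightarrow>
     (\<forall>t. X t \<in> measurable M (count_space S)) \<and>
     (\<forall>t x y. (\<forall>s\<le>t. x s \<in> S) \<longrightarrow> y \<in> S \<longrightarrow>
        \<P>(\<omega> in M. \<forall>s\<le>t. X s \<omega> = x s) > 0 \<longrightarrow>
        \<P>(\<omega> in M. X (Suc t) \<omega> = y \<bar> \<forall>s\<le>t. X s \<omega> = x s) = pmf (K (x t)) y)"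

definition counter_kernel :: "real \<Rightarrow> nat \<Rightarrow> nat pmf" where
  "counter_kernel a l = map_pmf (\<lambda>b. if b then l + 1 else l) (bernoulli_pmf (a ^ l))"

definition exp_series :: "real \<Rightarrow> (nat \<Rightarrow> 'v \<Rightarrow> real) \<Rightarrow> 'v \<Rightarrow> real" where
  "exp_series a E \<omega> = (\<Sum>k. a ^ k * E k \<omega>)"

definition rand_F :: "real \<Rightarrow> ('v \<Rightarrow> real) \<Rightarrow> real \<Rightarrow> 'v \<Rightarrow> real" where
  "rand_F a H x \<omega> = log (1 / a) (1 / (a * H \<omega>)) - frac (x - log (1 / a) (H \<omega>))"

text \<open>Meant for probability measures with the same \<open>\<sigma>\<close>-algebra.\<close>

definition tv_dist :: "'b measure \<Rightarrow> 'b measure \<Rightarrow> real" where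
  "tv_dist P Q = (SUP A\<in>sets P. \<bar>measure P A - measure Q A\<bar>)"

text \<open>
  Neither of the two families compared below converges in law, so equivalence of their
  distributions means that the distance between the laws tends to 0. At each time both variables
  live on the same translate of the integers, so total variation is meaningful here.
\<close>

definition asymp_equiv_laws :: "(nat \<Rightarrow> 'b measure) \<Rightarrow> (nat \<Rightarrow> 'b measure) \<Rightarrow> bool" where
  "asymp_equiv_laws P Q \<longleftrightarrow> (\<lambda>t. tv_dist (P t) (Q t)) \<longlonglongrightarrow> 0"

end

theory Submission
  imports Defs
begin

text \<open>
  Almost surely \<open>F (log t) + log t = 1 + \<lfloor>log (t / H)\<rfloor>\<close> (logarithms to base \<open>1 / a\<close>), so that with
  \<open>G\<close> the distribution function of \<open>H\<close> the tails to compare are \<open>p t n = P (L t > n)\<close> and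
  \<open>q t n = G (a ^ n * t)\<close>. The former satisfies
  \<open>p (t + 1) n = p t n + a ^ n * (p t (n - 1) - p t n)\<close>. Since \<open>H\<close> has the law of \<open>E + a * H\<close> with
  \<open>E\<close> exponential and independent of \<open>H\<close>, memorylessness shows that \<open>q\<close> satisfies the same
  recursion up to errors whose sum over all \<open>t\<close> is \<open>O(a ^ n)\<close>. The difference \<open>d = p - q\<close> vanishes at
  \<open>t = 0\<close>, \<open>n > 0\<close>, and \<open>\<Sum>t. \<bar>d t 0\<bar> = \<Sum>t. P (H > t)\<close> is finite because \<open>H\<close> is integrable. Summing the
  recursion over \<open>t\<close> yields \<open>\<Sum>t. \<bar>d t n\<bar> = O(n + 1)\<close>, and inserting this into the recursion once more
  yields \<open>\<bar>d t n\<bar> = O((n + 1) * a ^ n)\<close> uniformly in \<open>t\<close>. This bound is summable in \<open>n\<close>, and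
  both laws give vanishing mass to any fixed half-line \<open>{..k}\<close>, whence convergence in total variation.
\<close>

section \<open>Convergence, positivity and integrability of the exponential series\<close>

lemma exp_distributed_AE_pos:
  assumes "prob_space N" and "distributed N lborel X (exponential_density 1)"
  shows "AE \<omega> in N. 0 < (X \<omega> :: real)"
proof -
  interpret prob_space N by fact
  have [measurable]: "X \<in> borel_measurable N"
    using assms(2) distributed_measurable by fastforce
  have "prob {\<omega> \<in> space N. X \<omega> \<le> 0} = 0"
    using exponential_distributedD_le[OF assms(2), of 0] by simp
  then show ?thesis
    by (subst (asm) prob_eq_0) (auto simp: not_le)
qed

lemma exp_series_measurable:
  assumes "\<And>k. E k \<in> borel_measurable N"
  shows "exp_series a E \<in> borel_measurable N"
  unfolding exp_series_def using assms by measurable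

text \<open>By monotone convergence in \<open>ennreal\<close>, the expectation of the series is the
  geometric series in \<open>a\<close>, since every term has mean 1. A finite expectation forces the
  extended series to be finite almost surely, which yields real summability and integrability
  together.\<close>

lemma exp_series_props:
  fixes E :: "nat \<Rightarrow> 'v \<Rightarrow> real"
  assumes a: "0 < a" "a < 1" and N: "prob_space N"
    and E: "\<And>k. distributed N lborel (E k) (exponential_density 1)"
  shows exp_series_AE_summable: "AE \<omega> in N. summable (\<lambda>k. a ^ k * E k \<omega>)"
    and exp_series_AE_pos: "AE \<omega> in N. 0 < exp_series a E \<omega>"
    and exp_series_integrable: "integrable N (exp_series a E)"
proof -
  interpret prob_space N by fact
  have [measurable]: "E k \<in> borel_measurable N" for k
    using E[of k] distributed_measurable by fastforce
  have pos: "AE \<omega> in N. \<forall>k. 0 < E k \<omega>"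
    using exp_distributed_AE_pos[OF N E] by (simp add: AE_all_countable)
  have int: "integrable N (E k)" "expectation (E k) = 1" for k
    using erlang_ith_moment_integrable[OF _ E[of k], of 1] exponential_distributed_expectation[OF _ E[of k]]
    by simp_all
  have 1: "(\<integral>\<^sup>+\<omega>. ennreal (E k \<omega>) \<partial>N) = 1" for k
    using nn_integral_eq_integral[OF int(1)[of k]] int(2)[of k] pos
    by (simp add: eventually_mono less_imp_le)
  have "(\<integral>\<^sup>+\<omega>. (\<Sum>k. ennreal (a ^ k * E k \<omega>)) \<partial>N) = (\<Sum>k. \<integral>\<^sup>+\<omega>. ennreal (a ^ k * E k \<omega>) \<partial>N)"
    by (rule nn_integral_suminf) simp
  also have "\<dots> = (\<Sum>k. ennreal (a ^ k))"
    using a by (simp add: ennreal_mult' nn_integral_cmult 1)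
  also have "\<dots> = ennreal (\<Sum>k. a ^ k)"
    using a by (intro suminf_ennreal2 summable_geometric) auto
  finally have fin: "(\<integral>\<^sup>+\<omega>. (\<Sum>k. ennreal (a ^ k * E k \<omega>)) \<partial>N) < \<infinity>"
    by simp
  then have "AE \<omega> in N. (\<Sum>k. ennreal (a ^ k * E k \<omega>)) \<noteq> \<infinity>"
    by (intro nn_integral_noteq_infinite) auto
  with pos show S: "AE \<omega> in N. summable (\<lambda>k. a ^ k * E k \<omega>)"
  proof eventually_elim
    case (elim \<omega>)
    then show ?case
      using a by (intro summable_suminf_not_top) (auto simp: less_imp_le)
  qed
  from S pos show "AE \<omega> in N. 0 < exp_series a E \<omega>"
    unfolding exp_series_def by eventually_elim (use a in \<open>auto intro!: suminf_pos\<close>)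
  have "(\<integral>\<^sup>+\<omega>. ennreal (norm (exp_series a E \<omega>)) \<partial>N) \<le> (\<integral>\<^sup>+\<omega>. (\<Sum>k. ennreal (a ^ k * E k \<omega>)) \<partial>N)"
  proof (rule nn_integral_mono_AE)
    from S pos show "AE \<omega> in N. ennreal (norm (exp_series a E \<omega>)) \<le> (\<Sum>k. ennreal (a ^ k * E k \<omega>))"
    proof eventually_elim
      case (elim \<omega>)
      then have "0 \<le> exp_series a E \<omega>"
        unfolding exp_series_def using a by (intro suminf_nonneg) (auto simp: less_imp_le)
      moreover have "(\<Sum>k. ennreal (a ^ k * E k \<omega>)) = ennreal (exp_series a E \<omega>)"
        unfolding exp_series_def using elim a by (intro suminf_ennreal2) (auto simp: less_imp_le)
      ultimately show ?case by simp
    qed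
  qed
  with fin show "integrable N (exp_series a E)"
    by (intro integrableI_bounded exp_series_measurable) auto
qed

section \<open>Canonical space of independent exponential variables\<close>

definition exp_dist :: "real measure" where
  "exp_dist = density lborel (exponential_density 1)"

text \<open>On this product space, prepending an independent first coordinate preserves the measure,
  so the self-similarity of the series can be proved for one concrete realization;
  \<open>distr_indep_exp\<close> carries the result to an arbitrary probability space.\<close>

definition exp_seq :: "(nat \<Rightarrow> real) measure" where
  "exp_seq = PiM UNIV (\<lambda>_. exp_dist)"

lemma sets_exp_dist [measurable_cong, simp]: "sets exp_dist = sets borel"
  by (simp add: exp_dist_def)

lemma space_exp_dist [simp]: "space exp_dist = UNIV"
  by (simp add: exp_dist_def)

lemma prob_space_exp_dist: "prob_space exp_dist"
  unfolding exp_dist_def by (rule prob_space_exponential_density) simp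

lemma prob_space_exp_seq: "prob_space exp_seq"
  unfolding exp_seq_def by (intro prob_space_PiM prob_space_exp_dist)

lemma sets_exp_seq [measurable_cong]: "sets exp_seq = sets (PiM UNIV (\<lambda>_. borel))"
  unfolding exp_seq_def by (intro sets_PiM_cong) auto

lemma exp_seq_coord_distributed:
  "distributed exp_seq lborel (\<lambda>\<omega>. \<omega> k) (exponential_density 1)"
proof -
  have "distr exp_seq exp_dist (\<lambda>\<omega>. \<omega> k) = exp_dist"
    unfolding exp_seq_def using distr_PiM_component[of UNIV "\<lambda>_. exp_dist" k]
    by (simp add: prob_space_exp_dist)
  then have "distr exp_seq lborel (\<lambda>\<omega>. \<omega> k) = density lborel (exponential_density 1)"
    using distr_cong[of exp_seq exp_seq lborel exp_dist "\<lambda>\<omega>. \<omega> k" "\<lambda>\<omega>. \<omega> k"]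
    by (simp add: exp_dist_def)
  then show ?thesis
    unfolding distributed_def by (auto simp: exponential_density_nonneg)
qed

lemma distr_indep_exp:
  assumes N: "prob_space N" and indep: "prob_space.indep_vars N (\<lambda>_. borel) E UNIV"
    and E: "\<And>k::nat. distributed N lborel (E k) (exponential_density 1)"
  shows "distr N (PiM UNIV (\<lambda>_. borel)) (\<lambda>\<omega> i. E i \<omega>) = exp_seq"
proof -
  interpret prob_space N by fact
  have [measurable]: "E k \<in> borel_measurable N" for k
    using E[of k] distributed_measurable by fastforce
  have "distr N borel (E k) = exp_dist" for k
    using distributed_distr_eq_density[OF E[of k]]
      distr_cong[of N N borel lborel "E k" "E k"] by (simp add: exp_dist_def)
  with indep show ?thesis
    by (subst (asm) indep_vars_iff_distr_eq_PiM) (auto simp: exp_seq_def restrict_UNIV)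
qed

abbreviation coord_series :: "real \<Rightarrow> (nat \<Rightarrow> real) \<Rightarrow> real" where
  "coord_series a \<equiv> exp_series a (\<lambda>k \<omega>. \<omega> k)"

lemma coord_series_measurable [measurable]: "coord_series a \<in> borel_measurable exp_seq"
  by (rule exp_series_measurable) measurable

lemma
  assumes "0 < a" "a < 1"
  shows coord_series_AE_summable: "AE \<omega> in exp_seq. summable (\<lambda>k. a ^ k * \<omega> k)"
    and coord_series_AE_pos: "AE \<omega> in exp_seq. 0 < coord_series a \<omega>"
    and coord_series_integrable: "integrable exp_seq (coord_series a)"
  using exp_series_props[OF assms prob_space_exp_seq exp_seq_coord_distributed] .

definition H_cdf :: "real \<Rightarrow> real \<Rightarrow> real" where
  "H_cdf a x = \<P>(\<omega> in exp_seq. coord_series a \<omega> \<le> x)"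

text \<open>The series is a measurable function of the whole sequence \<open>E\<close>, so its law
  depends only on the joint law, which is that of the canonical space.\<close>

lemma prob_exp_series_le:
  assumes N: "prob_space N" and indep: "prob_space.indep_vars N (\<lambda>_. borel) E UNIV"
    and E: "\<And>k::nat. distributed N lborel (E k) (exponential_density 1)"
  shows "\<P>(\<omega> in N. exp_series a E \<omega> \<le> x) = H_cdf a x"
proof -
  have [measurable]: "E k \<in> borel_measurable N" for k
    using E[of k] distributed_measurable by fastforce
  have "H_cdf a x = measure (distr N (PiM UNIV (\<lambda>_. borel)) (\<lambda>\<omega> i. E i \<omega>))
      {\<omega> \<in> space exp_seq. coord_series a \<omega> \<le> x}"
    by (simp add: H_cdf_def distr_indep_exp[OF assms])
  also have "\<dots> = \<P>(\<omega> in N. exp_series a E \<omega> \<le> x)"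
  proof (subst measure_distr)
    show "(\<lambda>\<omega> i. E i \<omega>) \<in> measurable N (PiM UNIV (\<lambda>_. borel))"
      by (intro measurable_PiM_single') auto
    show "{\<omega> \<in> space exp_seq. coord_series a \<omega> \<le> x} \<in> sets (PiM UNIV (\<lambda>_. borel))"
      unfolding sets_exp_seq[symmetric] by measurable
  qed (auto simp: exp_series_def space_PiM exp_seq_def intro!: arg_cong[where f="measure N"])
  finally show ?thesis by simp
qed

section \<open>Memorylessness and self-similarity of the law of the series\<close>

text \<open>Memorylessness in a form suited to slices of a product: beyond \<open>b\<close> the
  exponential law is a copy of itself, scaled by the probability of exceeding \<open>b\<close>. For
  negative \<open>z\<close> the interval on the left is empty and the right side has no
  mass.\<close>

lemma emeasure_exp_dist_shift:
  assumes "0 < b"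
  shows "emeasure exp_dist {b<..b+z} = ennreal (exp (- b)) * emeasure exp_dist {..z}"
proof (cases "0 \<le> z")
  case True
  interpret prob_space exp_dist by (rule prob_space_exp_dist)
  have D: "distributed exp_dist lborel (\<lambda>x. x) (exponential_density 1)"
    by (auto simp: distributed_def exp_dist_def distr_id2 exponential_density_nonneg)
  have *: "prob {..x} = 1 - exp (- x)" if "0 \<le> x" for x
    using exponential_distributedD_le[OF D that] by (simp add: atMost_def)
  have "{b<..b+z} = {..b+z} - {..b}" by auto
  then have "prob {b<..b+z} = prob {..b+z} - prob {..b}"
    using assms True by (simp add: finite_measure_Diff)
  also have "\<dots> = exp (- b) * prob {..z}"
    using assms True by (simp add: * algebra_simps flip: exp_add)
  finally show ?thesis
    by (simp add: emeasure_eq_measure ennreal_mult')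
next
  case False
  have "{..z} \<subseteq> {..0}" using False by auto
  moreover have "emeasure exp_dist {..0} = 0"
    using emeasure_erlang_density[of 1 0 0] by (simp add: exp_dist_def erlang_CDF_0)
  ultimately have "emeasure exp_dist {..z} = 0"
    by (metis emeasure_eq_0 sets_exp_dist atMost_borel)
  with False show ?thesis by simp
qed

text \<open>The distributional identity H = E + a * H: the map \<open>case_nat\<close> sends the
  product of \<open>exp_dist\<close> and \<open>exp_seq\<close> to \<open>exp_seq\<close>, and
  removing the first term of the series leaves \<open>a\<close> times the series of the remaining
  coordinates.\<close>

lemma H_cdf_pair:
  assumes a: "0 < a" "a < 1"
  shows "H_cdf a x = \<P>(z in exp_dist \<Otimes>\<^sub>M exp_seq. fst z + a * coord_series a (snd z) \<le> x)"
proof -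
  interpret E: prob_space exp_dist by (rule prob_space_exp_dist)
  interpret sequence_space exp_dist ..
  let ?Q = "exp_dist \<Otimes>\<^sub>M exp_seq"
  have eq: "distr ?Q exp_seq (\<lambda>(s, \<omega>). case_nat s \<omega>) = exp_seq"
    using PiM_iter by (simp add: exp_seq_def)
  have m[measurable]: "(\<lambda>(s, \<omega>). case_nat s \<omega>) \<in> measurable ?Q exp_seq"
    unfolding exp_seq_def by measurable
  \<comment> \<open>\<open>suminf\<close> carries no information for a divergent series, so the
    first term can be split off only where the series converges. Almost sure convergence is
    therefore pulled back along the measure-preserving map first.\<close>
  have "AE \<omega> in exp_seq. summable (\<lambda>k. a ^ k * \<omega> k)"
    by (rule coord_series_AE_summable[OF a])
  then have "AE \<omega> in distr ?Q exp_seq (\<lambda>(s, \<omega>). case_nat s \<omega>). summable (\<lambda>k. a ^ k * \<omega> k)"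
    unfolding eq .
  then have "AE z in ?Q. summable (\<lambda>k. a ^ k * (case_nat (fst z) (snd z) k))"
    by (auto dest!: AE_distrD[OF m] simp: case_prod_beta)
  then have AE: "AE z in ?Q. coord_series a (case_nat (fst z) (snd z)) = fst z + a * coord_series a (snd z)"
  proof eventually_elim
    case (elim z)
    then have "summable (\<lambda>k. a ^ Suc k * snd z k)"
      by (subst (asm) summable_Suc_iff[symmetric]) simp
    then have "summable (\<lambda>k. a ^ k * snd z k)"
      using a summable_mult_D[of a "\<lambda>k. a ^ k * snd z k"] by (simp add: mult.assoc)
    then show ?case
      using suminf_split_head[OF elim] suminf_mult[of "\<lambda>k. a ^ k * snd z k" a]
      by (simp add: exp_series_def mult.assoc)
  qed
  have "H_cdf a x = measure (distr ?Q exp_seq (\<lambda>(s, \<omega>). case_nat s \<omega>)) {\<omega> \<in> space exp_seq. coord_series a \<omega> \<le> x}"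
    unfolding eq by (simp add: H_cdf_def)
  also have "\<dots> = \<P>(z in ?Q. coord_series a (case_nat (fst z) (snd z)) \<le> x)"
  proof (subst measure_distr[OF m])
    show "{\<omega> \<in> space exp_seq. coord_series a \<omega> \<le> x} \<in> sets exp_seq"
      by measurable
  qed (auto simp: space_pair_measure exp_seq_def space_PiM case_prod_beta intro!: arg_cong[where f="measure _"])
  also have "\<dots> = \<P>(z in ?Q. fst z + a * coord_series a (snd z) \<le> x)"
  proof (rule measure_eq_AE)
    have [measurable]: "(\<lambda>z. coord_series a (case_nat (fst z) (snd z))) \<in> borel_measurable ?Q"
      using measurable_compose[OF m coord_series_measurable] by (simp add: case_prod_beta)
    show "{z \<in> space ?Q. coord_series a (case_nat (fst z) (snd z)) \<le> x} \<in> sets ?Q"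
      by measurable
    show "{z \<in> space ?Q. fst z + a * coord_series a (snd z) \<le> x} \<in> sets ?Q"
      by measurable
  qed (use AE in auto)
  finally show ?thesis .
qed

text \<open>Split H = E + a * H according to whether E exceeds \<open>b\<close>. Above
  \<open>b\<close>, memorylessness gives the term \<open>exp (- b) * H_cdf a x\<close> exactly;
  below, E lies between 0 and \<open>b\<close>, which confines the threshold for a * H to the range
  from \<open>x\<close> to \<open>x + b\<close>. Taking \<open>b\<close> to be a power of
  \<open>a\<close> turns this into one time step of the limiting tails.\<close>

lemma H_cdf_step:
  assumes a: "0 < a" "a < 1" and b: "0 < b"
  shows "exp (- b) * H_cdf a x + (1 - exp (- b)) * H_cdf a (x / a) \<le> H_cdf a (x + b)" (is ?low)
    and "H_cdf a (x + b) \<le> exp (- b) * H_cdf a x + (1 - exp (- b)) * H_cdf a ((x + b) / a)" (is ?up)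
proof -
  interpret P: prob_space exp_dist by (rule prob_space_exp_dist)
  interpret S: prob_space exp_seq by (rule prob_space_exp_seq)
  interpret PS: pair_prob_space exp_dist exp_seq ..
  let ?Q = "exp_dist \<Otimes>\<^sub>M exp_seq"
  let ?h = "coord_series a"
  define A where "A = {z \<in> space ?Q. fst z + a * ?h (snd z) \<le> x + b \<and> b < fst z}"
  define B where "B = {z \<in> space ?Q. fst z + a * ?h (snd z) \<le> x + b \<and> fst z \<le> b}"
  have AB[measurable]: "A \<in> sets ?Q" "B \<in> sets ?Q"
    unfolding A_def B_def by measurable
  have "emeasure ?Q A = (\<integral>\<^sup>+y. emeasure exp_dist ((\<lambda>s. (s, y)) -` A) \<partial>exp_seq)"
    by (rule PS.emeasure_pair_measure_alt2[OF AB(1)])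
  also have "\<dots> = (\<integral>\<^sup>+y. ennreal (exp (- b)) * emeasure exp_dist ((\<lambda>s. (s, y)) -` {z \<in> space ?Q. fst z + a * ?h (snd z) \<le> x}) \<partial>exp_seq)"
  proof (intro nn_integral_cong)
    fix y assume y: "y \<in> space exp_seq"
    have "(\<lambda>s. (s, y)) -` A = {b<..b + (x - a * ?h y)}"
      using y by (auto simp: A_def space_pair_measure)
    moreover have "(\<lambda>s. (s, y)) -` {z \<in> space ?Q. fst z + a * ?h (snd z) \<le> x} = {..x - a * ?h y}"
      using y by (auto simp: space_pair_measure)
    ultimately show "emeasure exp_dist ((\<lambda>s. (s, y)) -` A) =
      ennreal (exp (- b)) * emeasure exp_dist ((\<lambda>s. (s, y)) -` {z \<in> space ?Q. fst z + a * ?h (snd z) \<le> x})"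
      using emeasure_exp_dist_shift[OF b] by metis
  qed
  also have "\<dots> = ennreal (exp (- b)) * emeasure ?Q {z \<in> space ?Q. fst z + a * ?h (snd z) \<le> x}"
    by (subst PS.emeasure_pair_measure_alt2, measurable)
      (intro nn_integral_cmult PS.measurable_emeasure_Pair2, measurable)
  finally have A: "measure ?Q A = exp (- b) * H_cdf a x"
    by (simp add: H_cdf_pair[OF a] PS.emeasure_eq_measure ennreal_mult'[symmetric])
  have D: "distributed exp_dist lborel (\<lambda>x. x) (exponential_density 1)"
    by (auto simp: distributed_def exp_dist_def distr_id2 exponential_density_nonneg)
  have *: "P.prob {..b} = 1 - exp (- b)"
    using P.exponential_distributedD_le[OF D, of b] b by (simp add: atMost_def)
  have prod: "measure ?Q ({..b} \<times> {\<omega> \<in> space exp_seq. ?h \<omega> \<le> y}) = (1 - exp (- b)) * H_cdf a y" for y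
    unfolding H_cdf_def measure_def
    by (subst S.emeasure_pair_measure_Times) (auto simp: enn2real_mult * simp flip: measure_def)
  have "{z \<in> space ?Q. fst z + a * ?h (snd z) \<le> x + b} = A \<union> B" "A \<inter> B = {}"
    by (auto simp: A_def B_def)
  then have split: "H_cdf a (x + b) = measure ?Q A + measure ?Q B"
    by (simp add: H_cdf_pair[OF a] PS.finite_measure_Union[OF AB])
  \<comment> \<open>On \<open>fst z \<le> b\<close>, the condition
    \<open>a * ?h (snd z) \<le> x\<close> is sufficient for \<open>B\<close>; since the first
    coordinate is almost surely positive, \<open>a * ?h (snd z) \<le> x + b\<close> is necessary.
    Both comparison sets are rectangles, so their measures factor.\<close>
  have "measure ?Q ({..b} \<times> {\<omega> \<in> space exp_seq. ?h \<omega> \<le> x / a}) \<le> measure ?Q B"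
    using a by (intro PS.finite_measure_mono) (auto simp: B_def space_pair_measure field_simps)
  with split A prod show ?low by simp
  have "AE s in exp_dist. 0 < s"
    by (rule exp_distributed_AE_pos[OF prob_space_exp_dist D])
  moreover have "{z \<in> space ?Q. 0 < fst z} \<in> sets ?Q"
    by measurable
  ultimately have "AE z in ?Q. 0 < fst z"
    by (intro PS.AE_pair_measure) auto
  then have "AE z in ?Q. z \<in> B \<longrightarrow> z \<in> {..b} \<times> {\<omega> \<in> space exp_seq. ?h \<omega> \<le> (x + b) / a}"
    by eventually_elim (use a in \<open>auto simp: B_def space_pair_measure field_simps\<close>)
  then have "measure ?Q B \<le> measure ?Q ({..b} \<times> {\<omega> \<in> space exp_seq. ?h \<omega> \<le> (x + b) / a})"
    by (intro PS.finite_measure_mono_AE) auto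
  with split A prod show ?up by simp
qed

section \<open>Tail sums and limits of the distribution function\<close>

text \<open>The sum is the expected number of \<open>t < T\<close> with
  \<open>c * real t < X \<omega>\<close>, and at most \<open>1 + X \<omega> / c\<close> integers
  qualify.\<close>

lemma sum_prob_greater_le:
  assumes M: "prob_space M" and X: "integrable M X" "AE \<omega> in M. 0 \<le> X \<omega>" and c: "0 < c"
  shows "(\<Sum>t<T. \<P>(\<omega> in M. c * real t < X \<omega>)) \<le> 1 + integral\<^sup>L M X / c"
proof -
  interpret prob_space M by fact
  have [measurable]: "X \<in> borel_measurable M" using X by auto
  let ?I = "\<lambda>t \<omega>. indicator {\<omega> \<in> space M. c * real t < X \<omega>} \<omega> :: real"
  have int: "integrable M (?I t)" for t
    by (simp add: integrable_indicator_iff less_top[symmetric])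
  have "(\<Sum>t<T. \<P>(\<omega> in M. c * real t < X \<omega>)) = (\<integral>\<omega>. (\<Sum>t<T. ?I t \<omega>) \<partial>M)"
    using int by (subst Bochner_Integration.integral_sum) auto
  also have "\<dots> \<le> (\<integral>\<omega>. 1 + X \<omega> / c \<partial>M)"
  proof (rule integral_mono_AE)
    from X(2) show "AE \<omega> in M. (\<Sum>t<T. ?I t \<omega>) \<le> 1 + X \<omega> / c"
    proof eventually_elim
      case (elim \<omega>)
      have "(\<Sum>t<T. ?I t \<omega>) \<le> (\<Sum>t<T. indicator {t. c * real t < X \<omega>} t)"
        by (intro sum_mono) (auto simp: indicator_def)
      also have "\<dots> = real (card ({..<T} \<inter> {t. c * real t < X \<omega>}))"
        by (simp add: indicator_def sum.If_cases)
      also have "\<dots> \<le> real (card {..nat \<lfloor>X \<omega> / c\<rfloor>})"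
      proof (intro of_nat_mono card_mono)
        show "{..<T} \<inter> {t. c * real t < X \<omega>} \<subseteq> {..nat \<lfloor>X \<omega> / c\<rfloor>}"
          using c elim by (auto simp: le_nat_floor field_simps)
      qed simp
      also have "\<dots> \<le> 1 + X \<omega> / c"
        using c elim by simp
      finally show ?case .
    qed
  qed (use X int in auto)
  also have "\<dots> = 1 + integral\<^sup>L M X / c"
    using X by (simp add: prob_space)
  finally show ?thesis .
qed

lemma H_cdf_bounds: "0 \<le> H_cdf a x" "H_cdf a x \<le> 1"
proof -
  interpret prob_space exp_seq by (rule prob_space_exp_seq)
  show "0 \<le> H_cdf a x" "H_cdf a x \<le> 1"
    by (simp_all add: H_cdf_def)
qed

lemma H_cdf_mono: "x \<le> y \<Longrightarrow> H_cdf a x \<le> H_cdf a y"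
proof -
  interpret prob_space exp_seq by (rule prob_space_exp_seq)
  show "x \<le> y \<Longrightarrow> H_cdf a x \<le> H_cdf a y"
    unfolding H_cdf_def by (intro finite_measure_mono) auto
qed

lemma H_cdf_compl: "1 - H_cdf a x = \<P>(\<omega> in exp_seq. x < coord_series a \<omega>)"
proof -
  interpret prob_space exp_seq by (rule prob_space_exp_seq)
  show ?thesis
    unfolding H_cdf_def by (subst prob_neg[symmetric]) (auto simp: not_le)
qed

lemma H_cdf_0:
  assumes a: "0 < a" "a < 1"
  shows "H_cdf a 0 = 0"
proof -
  interpret prob_space exp_seq by (rule prob_space_exp_seq)
  have "AE \<omega> in exp_seq. 0 < coord_series a \<omega>"
    by (rule coord_series_AE_pos[OF a])
  then show ?thesis
    unfolding H_cdf_def by (intro prob_eq_0_AE) (auto simp: not_le)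
qed

definition H_mean :: "real \<Rightarrow> real" where
  "H_mean a = integral\<^sup>L exp_seq (coord_series a)"

lemma H_cdf_tail_sum:
  assumes a: "0 < a" "a < 1" and c: "0 < c"
  shows "(\<Sum>t<T. 1 - H_cdf a (c * real t)) \<le> 1 + H_mean a / c"
  unfolding H_cdf_compl H_mean_def
  using coord_series_AE_pos[OF a]
  by (intro sum_prob_greater_le prob_space_exp_seq c
      coord_series_integrable[OF a]) auto

lemma H_mean_nonneg:
  assumes a: "0 < a" "a < 1"
  shows "0 \<le> H_mean a"
  unfolding H_mean_def
  using coord_series_AE_pos[OF a]
  by (intro integral_nonneg_AE) auto

text \<open>The tails along \<open>c * real t\<close> are summable by integrability of H, hence they
  tend to 0.\<close>

lemma H_cdf_tendsto:
  assumes a: "0 < a" "a < 1" and c: "0 < c"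
  shows "(\<lambda>t. H_cdf a (c * real t)) \<longlonglongrightarrow> 1"
proof -
  have "summable (\<lambda>t. 1 - H_cdf a (c * real t))"
    using H_cdf_tail_sum[OF a c] by (intro summableI_nonneg_bounded) (auto simp: H_cdf_bounds)
  then have "(\<lambda>t. 1 - (1 - H_cdf a (c * real t))) \<longlonglongrightarrow> 1 - 0"
    by (intro tendsto_diff tendsto_const summable_LIMSEQ_zero)
  then show ?thesis by simp
qed

section \<open>Comparison of the two tail recursions\<close>

text \<open>Summed over time, level \<open>Suc n\<close> occurs on both sides, on the right with
  weight \<open>1 - h (Suc n)\<close>. Cancelling leaves a factor \<open>h (Suc n)\<close> on the
  left, which the inflow from level \<open>n\<close> and the errors also carry, so each level adds
  just one \<open>c\<close>. Once the sums are bounded, the increments of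
  \<open>\<bar>d t (Suc n)\<bar>\<close> in time add up to a multiple of \<open>h (Suc n)\<close>,
  which is the pointwise bound.\<close>

lemma triangular_error_bound:
  fixes d \<epsilon> :: "nat \<Rightarrow> nat \<Rightarrow> real"
  assumes h: "\<And>n. 0 < h n" "\<And>n. h n \<le> 1"
    and init: "\<And>n. d 0 (Suc n) = 0"
    and step: "\<And>t n. d (Suc t) (Suc n) = (1 - h (Suc n)) * d t (Suc n) + h (Suc n) * d t n + \<epsilon> t n"
    and err: "\<And>T n. (\<Sum>t<T. \<bar>\<epsilon> t n\<bar>) \<le> h (Suc n) * c"
    and base: "\<And>T. (\<Sum>t<T. \<bar>d t 0\<bar>) \<le> c"
  shows "(\<Sum>t<T. \<bar>d t n\<bar>) \<le> real (n + 1) * c"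
    and "\<bar>d t (Suc n)\<bar> \<le> h (Suc n) * (real (n + 2) * c)"
proof -
  have abs_step: "\<bar>d (Suc t) (Suc n)\<bar> \<le>
      (1 - h (Suc n)) * \<bar>d t (Suc n)\<bar> + h (Suc n) * \<bar>d t n\<bar> + \<bar>\<epsilon> t n\<bar>" for t n
  proof -
    have "\<bar>d (Suc t) (Suc n)\<bar> \<le>
      \<bar>(1 - h (Suc n)) * d t (Suc n)\<bar> + \<bar>h (Suc n) * d t n\<bar> + \<bar>\<epsilon> t n\<bar>"
      unfolding step by linarith
    then show ?thesis
      using h[of "Suc n"] by (simp add: abs_mult)
  qed
  show sums: "(\<Sum>t<T. \<bar>d t n\<bar>) \<le> real (n + 1) * c" for T n
  proof (induction n arbitrary: T)
    case 0
    then show ?case using base[of T] by simp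
  next
    case (Suc n)
    let ?S = "\<lambda>n. \<Sum>t<T. \<bar>d t n\<bar>"
    \<comment> \<open>One more term is added at the end and the initial term, zero by
      \<open>init\<close>, is dropped, so that every remaining term is the outcome of a step of the
      recursion.\<close>
    have "?S (Suc n) \<le> (\<Sum>t<Suc T. \<bar>d t (Suc n)\<bar>)"
      by simp
    also have "\<dots> = (\<Sum>t<T. \<bar>d (Suc t) (Suc n)\<bar>)"
      by (subst sum.lessThan_Suc_shift) (simp add: init)
    also have "\<dots> \<le> (\<Sum>t<T. (1 - h (Suc n)) * \<bar>d t (Suc n)\<bar> + h (Suc n) * \<bar>d t n\<bar> + \<bar>\<epsilon> t n\<bar>)"
      by (intro sum_mono abs_step)
    also have "\<dots> = (1 - h (Suc n)) * ?S (Suc n) + h (Suc n) * ?S n + (\<Sum>t<T. \<bar>\<epsilon> t n\<bar>)"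
      by (simp add: sum.distrib sum_distrib_left)
    finally have "h (Suc n) * ?S (Suc n) \<le> h (Suc n) * (?S n + c)"
      using err[of n T] by (simp add: algebra_simps)
    then have "?S (Suc n) \<le> ?S n + c"
      using h(1)[of "Suc n"] by simp
    with Suc[of T] show ?case by (simp add: algebra_simps)
  qed
  have "\<bar>d t (Suc n)\<bar> \<le> h (Suc n) * (\<Sum>s<t. \<bar>d s n\<bar>) + (\<Sum>s<t. \<bar>\<epsilon> s n\<bar>)"
  proof (induction t)
    case 0
    then show ?case by (simp add: init)
  next
    case (Suc t)
    have "(1 - h (Suc n)) * \<bar>d t (Suc n)\<bar> \<le> \<bar>d t (Suc n)\<bar>"
      using h[of "Suc n"] by (intro mult_left_le_one_le) auto
    with Suc abs_step[of t n] show ?case by (simp add: algebra_simps)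
  qed
  also have "\<dots> \<le> h (Suc n) * (real (n + 1) * c) + h (Suc n) * c"
    using h(1)[of "Suc n"] by (intro add_mono mult_left_mono sums err) auto
  finally show "\<bar>d t (Suc n)\<bar> \<le> h (Suc n) * (real (n + 2) * c)"
    by (simp add: algebra_simps)
qed

text \<open>The limiting tails satisfy the recursion of \<open>p\<close> up to an error whose sum
  over time has the factor \<open>a ^ Suc n\<close>, as \<open>triangular_error_bound\<close>
  demands with \<open>h n = a ^ n\<close>.\<close>

lemma tail_recursion_error:
  fixes p :: "nat \<Rightarrow> nat \<Rightarrow> real"
  assumes a: "0 < a" "a < 1"
    and p0: "\<And>t. p t 0 = 1" and init: "\<And>n. p 0 (Suc n) = 0"
    and step: "\<And>t n. p (Suc t) (Suc n) = p t (Suc n) + a ^ Suc n * (p t n - p t (Suc n))"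
  shows "\<bar>p t n - H_cdf a (a ^ n * real t)\<bar> \<le> real (n + 1) * a ^ n * (H_mean a + 2)"
proof -
  define q where "q t n = H_cdf a (a ^ n * real t)" for t n
  define d where "d t n = p t n - q t n" for t n
  define \<epsilon> where "\<epsilon> t n = (1 - a ^ Suc n) * q t (Suc n) + a ^ Suc n * q t n - q (Suc t) (Suc n)" for t n
  \<comment> \<open>The tail sum at scale \<open>a ^ Suc n\<close> contributes
    \<open>H_mean a + 1\<close> and a sum telescoping in time contributes 1.\<close>
  let ?c = "H_mean a + 2"
  have m: "0 \<le> H_mean a" using H_mean_nonneg[OF a] .
  have dstep: "d (Suc t) (Suc n) = (1 - a ^ Suc n) * d t (Suc n) + a ^ Suc n * d t n + \<epsilon> t n" for t n
    unfolding d_def \<epsilon>_def step by (simp add: algebra_simps)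
  \<comment> \<open>The first term is the cost of replacing \<open>exp (- h)\<close> by
    \<open>1 - h\<close> for \<open>h = a ^ Suc n\<close>. The second comes from the upper estimate
    of \<open>H_cdf_step\<close>, where level \<open>n\<close> is evaluated at \<open>Suc t\<close>
    instead of \<open>t\<close>.\<close>
  have eps: "\<bar>\<epsilon> t n\<bar> \<le> (a ^ Suc n)\<^sup>2 * (q t n - q t (Suc n)) + a ^ Suc n * (q (Suc t) n - q t n)" for t n
  proof -
    let ?h = "a ^ Suc n"
    let ?e = "exp (- ?h)"
    have h: "0 < ?h" "?h \<le> 1" using a by (auto intro: power_le_one simp del: power_Suc)
    \<comment> \<open>Adding \<open>?h\<close> to the argument advances time by one; dividing the
      argument by \<open>a\<close> lowers the level from \<open>Suc n\<close> to
      \<open>n\<close>.\<close>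
    have 1: "?h * real t + ?h = ?h * real (Suc t)" "?h * real s / a = a ^ n * real s" for s
      using a by (auto simp: field_simps)
    have low: "?e * q t (Suc n) + (1 - ?e) * q t n \<le> q (Suc t) (Suc n)"
      using H_cdf_step(1)[OF a h(1), of "?h * real t"] by (simp only: q_def 1)
    have up: "q (Suc t) (Suc n) \<le> ?e * q t (Suc n) + (1 - ?e) * q (Suc t) n"
      using H_cdf_step(2)[OF a h(1), of "?h * real t"] by (simp only: q_def 1)
    have e1: "1 - ?h \<le> ?e" using exp_ge_add_one_self[of "- ?h"] by simp
    have e2: "?e \<le> 1 - ?h + ?h\<^sup>2"
    proof -
      have "(1 + ?h) * ?e \<le> exp ?h * ?e"
        by (intro mult_right_mono) auto
      also have "\<dots> = 1" by (simp flip: exp_add)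
      \<comment> \<open>The product equals 1 plus the cube of \<open>?h\<close>.\<close>
      also have "1 \<le> (1 + ?h) * (1 - ?h + ?h\<^sup>2)"
        using h by (simp add: algebra_simps power2_eq_square del: power_Suc)
      finally show ?thesis using h by (subst (asm) mult_le_cancel_left_pos) auto
    qed
    have e3: "?e \<le> 1" using h by simp
    have q1: "0 \<le> q t n - q t (Suc n)"
      unfolding q_def using a by (auto intro!: H_cdf_mono mult_right_mono simp: mult_le_cancel_right1)
    have q2: "0 \<le> q (Suc t) n - q t n"
      unfolding q_def using a by (auto intro!: H_cdf_mono mult_left_mono)
    have "(?e - 1 + ?h) * (q t n - q t (Suc n)) \<le> ?h\<^sup>2 * (q t n - q t (Suc n))"
      using e2 q1 by (intro mult_right_mono) auto
    moreover have "0 \<le> (?e - 1 + ?h) * (q t n - q t (Suc n))"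
      using e1 q1 by (intro mult_nonneg_nonneg) auto
    moreover have "(1 - ?e) * (q (Suc t) n - q t n) \<le> ?h * (q (Suc t) n - q t n)"
      using e1 q2 by (intro mult_right_mono) auto
    moreover have "0 \<le> ?h\<^sup>2 * (q t n - q t (Suc n))" "0 \<le> ?h * (q (Suc t) n - q t n)"
      using q1 q2 h by auto
    ultimately show ?thesis
      using low up unfolding \<epsilon>_def by (simp add: algebra_simps del: power_Suc)
  qed
  have err: "(\<Sum>t<T. \<bar>\<epsilon> t n\<bar>) \<le> a ^ Suc n * ?c" for T n
  proof -
    let ?h = "a ^ Suc n"
    have h: "0 < ?h" "?h \<le> 1" using a by (auto intro: power_le_one simp del: power_Suc)
    \<comment> \<open>Bounding \<open>q t n\<close> by 1 leaves a tail sum of order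
      \<open>1 / ?h\<close>; multiplied by \<open>?h\<^sup>2\<close> it keeps the one factor
      \<open>?h\<close> that is wanted.\<close>
    have "(\<Sum>t<T. q t n - q t (Suc n)) \<le> (\<Sum>t<T. 1 - H_cdf a (?h * real t))"
      by (intro sum_mono) (simp add: q_def H_cdf_bounds)
    also have "\<dots> \<le> 1 + H_mean a / ?h"
      by (rule H_cdf_tail_sum[OF a h(1)])
    finally have 1: "?h\<^sup>2 * (\<Sum>t<T. q t n - q t (Suc n)) \<le> ?h\<^sup>2 * (1 + H_mean a / ?h)"
      by (intro mult_left_mono) auto
    have "?h\<^sup>2 * (1 + H_mean a / ?h) = ?h * (?h + H_mean a)"
      using h by (simp add: power2_eq_square field_simps del: power_Suc)
    also have "\<dots> \<le> ?h * (1 + H_mean a)"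
      using h by (intro mult_left_mono) auto
    finally have 2: "?h\<^sup>2 * (\<Sum>t<T. q t n - q t (Suc n)) \<le> ?h * (1 + H_mean a)"
      using 1 by linarith
    have "(\<Sum>t<T. q (Suc t) n - q t n) = q T n - q 0 n"
      by (rule sum_lessThan_telescope)
    also have "\<dots> \<le> 1"
      using H_cdf_bounds[of a "a ^ n * real T"] H_cdf_bounds[of a "a ^ n * real 0"] unfolding q_def by linarith
    finally have 3: "?h * (\<Sum>t<T. q (Suc t) n - q t n) \<le> ?h * 1"
      using h by (intro mult_left_mono) auto
    have "(\<Sum>t<T. \<bar>\<epsilon> t n\<bar>) \<le> (\<Sum>t<T. ?h\<^sup>2 * (q t n - q t (Suc n)) + ?h * (q (Suc t) n - q t n))"
      by (intro sum_mono eps)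
    also have "\<dots> = ?h\<^sup>2 * (\<Sum>t<T. q t n - q t (Suc n)) + ?h * (\<Sum>t<T. q (Suc t) n - q t n)"
      by (simp only: sum.distrib sum_distrib_left)
    also have "\<dots> \<le> ?h * ?c"
      using 2 3 by (simp add: algebra_simps del: power_Suc)
    finally show ?thesis .
  qed
  have base: "(\<Sum>t<T. \<bar>d t 0\<bar>) \<le> ?c" for T
  proof -
    have "(\<Sum>t<T. \<bar>d t 0\<bar>) = (\<Sum>t<T. 1 - H_cdf a (1 * real t))"
      by (intro sum.cong) (auto simp: d_def q_def p0 H_cdf_bounds)
    also have "\<dots> \<le> 1 + H_mean a / 1"
      by (rule H_cdf_tail_sum[OF a]) simp
    finally show ?thesis by simp
  qed
  have hpos: "0 < a ^ n" "a ^ n \<le> 1" for n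
    using a by (auto intro: power_le_one)
  have dinit: "d 0 (Suc n) = 0" for n
    using H_cdf_0[OF a] by (simp add: d_def init q_def)
  note bound = triangular_error_bound[of "\<lambda>n. a ^ n" d \<epsilon>, OF hpos dinit dstep err base]
  have "\<bar>d t n\<bar> \<le> real (n + 1) * a ^ n * ?c"
  proof (cases n)
    case 0
    \<comment> \<open>The pointwise bound of \<open>triangular_error_bound\<close> starts at level
      1; at level 0 the trivial bound is enough because \<open>?c\<close> is at least 2.\<close>
    have "\<bar>d t 0\<bar> \<le> 1"
      using H_cdf_bounds[of a "real t"] by (simp add: d_def q_def p0)
    then show ?thesis using 0 m by simp
  next
    case (Suc k)
    then show ?thesis using bound(2)[of t k] by (simp add: mult_ac)
  qed
  then show ?thesis by (simp add: d_def q_def)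
qed

section \<open>One-step probabilities and the tail recursion of the counter\<close>

text \<open>The definition of \<open>markov_chain\<close> conditions on the full past, whereas the
  recursion needs only the present state. Summing the full-past identity over all histories that end
  in \<open>x\<close> removes the past.\<close>

lemma markov_chain_pair_prob:
  assumes M: "prob_space M" and S: "countable S" and X: "markov_chain M S K X"
    and x: "x \<in> S" and y: "y \<in> S"
  shows "\<P>(\<omega> in M. X t \<omega> = x \<and> X (Suc t) \<omega> = y) = \<P>(\<omega> in M. X t \<omega> = x) * pmf (K x) y"
proof -
  interpret prob_space M by fact
  have XS: "X s \<in> measurable M (count_space S)" for s
    using X by (simp add: markov_chain_def)
  have [measurable]: "X s \<in> measurable M (count_space UNIV)" for s
    using measurable_compose[OF XS[of s], of "\<lambda>x. x" "count_space UNIV"] by simp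
  define A where "A xs = {\<omega> \<in> space M. \<forall>s\<le>t. X s \<omega> = xs ! s}" for xs
  define Y where "Y = {\<omega> \<in> space M. X (Suc t) \<omega> = y}"
  \<comment> \<open>Histories are lists of length \<open>Suc t\<close>, so that countability of
    \<open>S\<close> makes the decomposition of the event countable.\<close>
  define I where "I = {xs \<in> lists S. length xs = Suc t \<and> xs ! t = x}"
  have [measurable]: "A xs \<in> sets M" "Y \<in> sets M" for xs
    unfolding A_def Y_def by measurable
  have I: "countable I"
    unfolding I_def by (rule countable_subset[OF _ countable_lists[OF S]]) auto
  have disj: "disjoint_family_on A I"
    unfolding disjoint_family_on_def
  proof (intro ballI impI)
    fix xs ys assume "xs \<in> I" "ys \<in> I" "xs \<noteq> ys"
    then obtain s where "s \<le> t" "xs ! s \<noteq> ys ! s"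
      by (auto simp: I_def list_eq_iff_nth_eq less_Suc_eq_le)
    then show "A xs \<inter> A ys = {}"
      by (auto simp: A_def)
  qed
  then have disjY: "disjoint_family_on (\<lambda>xs. A xs \<inter> Y) I"
    by (auto simp: disjoint_family_on_def)
  have U: "{\<omega> \<in> space M. X t \<omega> = x} = (\<Union>xs\<in>I. A xs)"
  proof (intro equalityI subsetI)
    fix \<omega> assume \<omega>: "\<omega> \<in> {\<omega> \<in> space M. X t \<omega> = x}"
    let ?xs = "map (\<lambda>s. X s \<omega>) [0..<Suc t]"
    have "X s \<omega> \<in> S" for s
      using measurable_space[OF XS[of s]] \<omega> by auto
    then have "?xs \<in> I"
      using \<omega> by (auto simp: I_def nth_append)
    moreover have "\<omega> \<in> A ?xs"
      using \<omega> by (auto simp: A_def less_Suc_eq_le simp del: upt_Suc)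
    ultimately show "\<omega> \<in> (\<Union>xs\<in>I. A xs)" by blast
  qed (auto simp: A_def I_def)
  have step: "emeasure M (A xs \<inter> Y) = emeasure M (A xs) * ennreal (pmf (K x) y)" if xs: "xs \<in> I" for xs
  proof (cases "prob (A xs) > 0")
    case True
    have "\<forall>s\<le>t. xs ! s \<in> S"
      using xs by (auto simp: I_def less_Suc_eq_le[symmetric])
    moreover have "xs ! t = x" using xs by (simp add: I_def)
    ultimately have "cond_prob M (\<lambda>\<omega>. X (Suc t) \<omega> = y) (\<lambda>\<omega>. \<forall>s\<le>t. X s \<omega> = xs ! s) = pmf (K x) y"
      using X y True unfolding markov_chain_def A_def by blast
    moreover have "{\<omega> \<in> space M. X (Suc t) \<omega> = y \<and> (\<forall>s\<le>t. X s \<omega> = xs ! s)} = A xs \<inter> Y"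
      by (auto simp: A_def Y_def)
    ultimately have "prob (A xs \<inter> Y) = prob (A xs) * pmf (K x) y"
      using True by (simp add: cond_prob_def A_def[symmetric] field_simps)
    then show ?thesis
      by (simp add: emeasure_eq_measure ennreal_mult')
  next
    \<comment> \<open>A null history is not constrained by \<open>markov_chain\<close>, but then
      both sides vanish.\<close>
    case False
    then have "emeasure M (A xs) = 0"
      by (simp add: emeasure_eq_measure not_less measure_le_0_iff)
    then show ?thesis
      using emeasure_mono[of "A xs \<inter> Y" "A xs" M] by simp
  qed
  have "{\<omega> \<in> space M. X t \<omega> = x \<and> X (Suc t) \<omega> = y} = (\<Union>xs\<in>I. A xs) \<inter> Y"
    unfolding U[symmetric] by (auto simp: Y_def)
  then have "emeasure M {\<omega> \<in> space M. X t \<omega> = x \<and> X (Suc t) \<omega> = y} = emeasure M (\<Union>xs\<in>I. A xs \<inter> Y)"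
    by simp
  also have "\<dots> = (\<integral>\<^sup>+xs. emeasure M (A xs \<inter> Y) \<partial>count_space I)"
    by (rule emeasure_UN_countable[OF _ I disjY]) simp
  also have "\<dots> = (\<integral>\<^sup>+xs. emeasure M (A xs) * ennreal (pmf (K x) y) \<partial>count_space I)"
    by (rule nn_integral_cong) (simp add: step)
  also have "\<dots> = (\<integral>\<^sup>+xs. emeasure M (A xs) \<partial>count_space I) * ennreal (pmf (K x) y)"
    by (rule nn_integral_multc) simp
  also have "(\<integral>\<^sup>+xs. emeasure M (A xs) \<partial>count_space I) = emeasure M (\<Union>xs\<in>I. A xs)"
    by (rule emeasure_UN_countable[OF _ I disj, symmetric]) simp
  also have "\<dots> = emeasure M {\<omega> \<in> space M. X t \<omega> = x}"
    by (simp add: U)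
  finally show ?thesis
    by (simp add: emeasure_eq_measure ennreal_mult'[symmetric])
qed

lemma pmf_counter_kernel:
  assumes "0 \<le> a" "a \<le> 1"
  shows "pmf (counter_kernel a l) (Suc l) = a ^ l"
    and "y \<noteq> l \<Longrightarrow> y \<noteq> Suc l \<Longrightarrow> pmf (counter_kernel a l) y = 0"
proof -
  have "inj (\<lambda>b. if b then l + 1 else l)"
    by (auto simp: inj_def split: if_splits)
  from pmf_map_inj'[OF this, of "bernoulli_pmf (a ^ l)" True]
  show "pmf (counter_kernel a l) (Suc l) = a ^ l"
    using assms by (simp add: counter_kernel_def power_le_one)
  show "y \<noteq> l \<Longrightarrow> y \<noteq> Suc l \<Longrightarrow> pmf (counter_kernel a l) y = 0"
    by (auto simp: counter_kernel_def pmf_eq_0_set_pmf)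
qed

text \<open>The counter almost surely stays or moves up by one, so it exceeds \<open>Suc n\<close>
  at time \<open>Suc t\<close> either because it already did, or because it equals
  \<open>Suc n\<close> and jumps. The probability of being at \<open>Suc n\<close> is a difference
  of consecutive tails.\<close>

lemma counter_tail_recursion:
  assumes a: "0 \<le> a" "a \<le> 1" and M: "prob_space M"
    and L: "markov_chain M {1..} (counter_kernel a) L"
  defines "p \<equiv> \<lambda>t n. \<P>(\<omega> in M. n < L t \<omega>)"
  shows "p (Suc t) (Suc n) = p t (Suc n) + a ^ Suc n * (p t n - p t (Suc n))"
proof -
  interpret prob_space M by fact
  have LS: "L s \<in> measurable M (count_space {1..})" for s
    using L by (simp add: markov_chain_def)
  have [measurable]: "L s \<in> measurable M (count_space UNIV)" for s
    using measurable_compose[OF LS[of s], of "\<lambda>x. x" "count_space UNIV"] by simp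
  have pair: "\<P>(\<omega> in M. L t \<omega> = x \<and> L (Suc t) \<omega> = y) = \<P>(\<omega> in M. L t \<omega> = x) * pmf (counter_kernel a x) y"
    if "1 \<le> x" "1 \<le> y" for x y
    using that by (intro markov_chain_pair_prob[OF M _ L]) auto
  \<comment> \<open>Each forbidden transition is a null event, and there are only countably many of
    them.\<close>
  have "AE \<omega> in M. 1 \<le> x \<and> 1 \<le> y \<and> y \<noteq> x \<and> y \<noteq> Suc x \<longrightarrow> \<not> (L t \<omega> = x \<and> L (Suc t) \<omega> = y)" for x y
  proof (cases "1 \<le> x \<and> 1 \<le> y \<and> y \<noteq> x \<and> y \<noteq> Suc x")
    case True
    then have "\<P>(\<omega> in M. L t \<omega> = x \<and> L (Suc t) \<omega> = y) = 0"
      using pair[of x y] pmf_counter_kernel(2)[OF a, of y x] by simp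
    then show ?thesis
      by (subst (asm) prob_eq_0) auto
  qed auto
  then have "AE \<omega> in M. \<forall>x y. 1 \<le> x \<and> 1 \<le> y \<and> y \<noteq> x \<and> y \<noteq> Suc x \<longrightarrow> \<not> (L t \<omega> = x \<and> L (Suc t) \<omega> = y)"
    unfolding AE_all_countable by blast
  then have AE: "AE \<omega> in M. L (Suc t) \<omega> = L t \<omega> \<or> L (Suc t) \<omega> = Suc (L t \<omega>)"
  proof (rule AE_mp, intro AE_I2 impI)
    fix \<omega> assume "\<omega> \<in> space M"
    then have "1 \<le> L t \<omega>" "1 \<le> L (Suc t) \<omega>"
      using measurable_space[OF LS] by auto
    moreover assume "\<forall>x y. 1 \<le> x \<and> 1 \<le> y \<and> y \<noteq> x \<and> y \<noteq> Suc x \<longrightarrow> \<not> (L t \<omega> = x \<and> L (Suc t) \<omega> = y)"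
    ultimately show "L (Suc t) \<omega> = L t \<omega> \<or> L (Suc t) \<omega> = Suc (L t \<omega>)" by blast
  qed
  let ?A = "{\<omega> \<in> space M. Suc n < L t \<omega>}"
  let ?B = "{\<omega> \<in> space M. L t \<omega> = Suc n \<and> L (Suc t) \<omega> = Suc (Suc n)}"
  let ?C = "{\<omega> \<in> space M. L t \<omega> = Suc n}"
  have "p (Suc t) (Suc n) = prob (?A \<union> ?B)"
    unfolding p_def using AE by (intro measure_eq_AE) (auto elim!: eventually_mono)
  also have "\<dots> = prob ?A + prob ?B"
    by (intro finite_measure_Union) auto
  also have "prob ?B = prob ?C * a ^ Suc n"
    using pair[of "Suc n" "Suc (Suc n)"] pmf_counter_kernel(1)[OF a, of "Suc n"] by simp
  also have "prob ?C = p t n - p t (Suc n)"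
  proof -
    have "p t n = prob (?C \<union> ?A)"
      unfolding p_def by (intro arg_cong[where f=prob]) auto
    also have "\<dots> = prob ?C + prob ?A"
      by (intro finite_measure_Union) auto
    finally show ?thesis by (simp add: p_def)
  qed
  finally show ?thesis by (simp add: p_def mult_ac)
qed

section \<open>Comparing integer-valued laws through their tails\<close>

text \<open>The difference of the tails at \<open>k + int i\<close> and
  \<open>k + int (Suc i)\<close> is the point mass at \<open>k + 1 + int i\<close>, and the
  indicator selects the points of \<open>B\<close>.\<close>

lemma int_law_tail_sums:
  fixes X :: "'w \<Rightarrow> int"
  assumes M: "prob_space M" and [measurable]: "X \<in> measurable M (count_space UNIV)"
  shows "(\<lambda>i. indicator B (k + 1 + int i) * (\<P>(\<omega> in M. k + int i < X \<omega>) - \<P>(\<omega> in M. k + int (Suc i) < X \<omega>)))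
    sums \<P>(\<omega> in M. k < X \<omega> \<and> X \<omega> \<in> B)"
proof -
  interpret prob_space M by fact
  define D where "D i = {\<omega> \<in> space M. X \<omega> = k + 1 + int i \<and> X \<omega> \<in> B}" for i
  have "(\<lambda>i. prob (D i)) sums prob (\<Union>i. D i)"
    by (intro finite_measure_UNION) (auto simp: D_def disjoint_family_on_def)
  also have "(\<Union>i. D i) = {\<omega> \<in> space M. k < X \<omega> \<and> X \<omega> \<in> B}"
  proof (intro equalityI subsetI)
    fix \<omega> assume "\<omega> \<in> {\<omega> \<in> space M. k < X \<omega> \<and> X \<omega> \<in> B}"
    then have "\<omega> \<in> D (nat (X \<omega> - k - 1))"
      by (auto simp: D_def)
    then show "\<omega> \<in> (\<Union>i. D i)" by blast
  qed (auto simp: D_def)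
  finally have D_sums: "(\<lambda>i. prob (D i)) sums \<P>(\<omega> in M. k < X \<omega> \<and> X \<omega> \<in> B)" .
  have "prob (D i) = indicator B (k + 1 + int i) *
    (\<P>(\<omega> in M. k + int i < X \<omega>) - \<P>(\<omega> in M. k + int (Suc i) < X \<omega>))" for i
  proof (cases "k + 1 + int i \<in> B")
    case True
    have "{\<omega> \<in> space M. k + int i < X \<omega>} = D i \<union> {\<omega> \<in> space M. k + int (Suc i) < X \<omega>}"
    proof (intro equalityI subsetI)
      fix \<omega> assume \<omega>: "\<omega> \<in> {\<omega> \<in> space M. k + int i < X \<omega>}"
      show "\<omega> \<in> D i \<union> {\<omega> \<in> space M. k + int (Suc i) < X \<omega>}"
      proof (cases "k + int (Suc i) < X \<omega>")
        case False
        with \<omega> have "X \<omega> = k + 1 + int i" by auto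
        with \<omega> True show ?thesis by (simp add: D_def)
      qed (use \<omega> in auto)
    qed (auto simp: D_def)
    moreover have "prob (D i \<union> {\<omega> \<in> space M. k + int (Suc i) < X \<omega>}) =
      prob (D i) + \<P>(\<omega> in M. k + int (Suc i) < X \<omega>)"
      by (intro finite_measure_Union) (auto simp: D_def)
    ultimately show ?thesis using True by simp
  next
    case False
    then have "D i = {}" by (auto simp: D_def)
    with False show ?thesis by simp
  qed
  with D_sums show ?thesis by simp
qed

text \<open>Above \<open>k\<close>, the point masses differ by at most
  \<open>c i + c (Suc i)\<close>, so their total discrepancy is at most \<open>2 * suminf c\<close>
  whatever \<open>B\<close> is. Up to \<open>k\<close>, the masses themselves serve as the bound.
  Uniformity in \<open>B\<close> is what total variation requires.\<close>

lemma int_laws_diff_le: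
  fixes X :: "'w \<Rightarrow> int" and Y :: "'v \<Rightarrow> int"
  assumes M: "prob_space M" and [measurable]: "X \<in> measurable M (count_space UNIV)"
    and N: "prob_space N" and [measurable]: "Y \<in> measurable N (count_space UNIV)"
    and c: "summable c"
    and bound: "\<And>i. \<bar>\<P>(\<omega> in M. k + int i < X \<omega>) - \<P>(\<omega> in N. k + int i < Y \<omega>)\<bar> \<le> c i"
  shows "\<bar>\<P>(\<omega> in M. X \<omega> \<in> B) - \<P>(\<omega> in N. Y \<omega> \<in> B)\<bar>
    \<le> \<P>(\<omega> in M. X \<omega> \<le> k) + \<P>(\<omega> in N. Y \<omega> \<le> k) + 2 * suminf c"
proof -
  interpret M: prob_space M by fact
  interpret N: prob_space N by fact
  let ?x = "\<lambda>i. \<P>(\<omega> in M. k + int i < X \<omega>)" and ?y = "\<lambda>i. \<P>(\<omega> in N. k + int i < Y \<omega>)"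
  let ?f = "\<lambda>i. indicator B (k + 1 + int i) * (?x i - ?x (Suc i)) - indicator B (k + 1 + int i) * (?y i - ?y (Suc i)) :: real"
  have c0: "0 \<le> c i" for i
    using bound[of i] by linarith
  have sums: "?f sums (\<P>(\<omega> in M. k < X \<omega> \<and> X \<omega> \<in> B) - \<P>(\<omega> in N. k < Y \<omega> \<and> Y \<omega> \<in> B))"
    by (intro sums_diff int_law_tail_sums M N) measurable
  have fb: "\<bar>?f i\<bar> \<le> c i + c (Suc i)" for i
    using bound[of i] bound[of "Suc i"] by (auto simp: indicator_def)
  have c1: "summable (\<lambda>i. c (Suc i))"
    using c by (subst summable_Suc_iff)
  have "\<bar>suminf ?f\<bar> \<le> (\<Sum>i. c i + c (Suc i))"
    using fb c c1 by (intro norm_suminf_le[where 'a=real, unfolded real_norm_def] summable_add) auto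
  also have "\<dots> = suminf c + (\<Sum>i. c (Suc i))"
    using c c1 by (simp add: suminf_add)
  also have "(\<Sum>i. c (Suc i)) \<le> suminf c"
    using suminf_split_head[OF c] c0[of 0] by simp
  finally have upper: "\<bar>\<P>(\<omega> in M. k < X \<omega> \<and> X \<omega> \<in> B) - \<P>(\<omega> in N. k < Y \<omega> \<and> Y \<omega> \<in> B)\<bar> \<le> 2 * suminf c"
    using sums_unique[OF sums] by simp
  have "\<P>(\<omega> in M. X \<omega> \<in> B) = \<P>(\<omega> in M. k < X \<omega> \<and> X \<omega> \<in> B) + \<P>(\<omega> in M. X \<omega> \<le> k \<and> X \<omega> \<in> B)"
    by (subst M.finite_measure_Union[symmetric]) (auto intro!: arg_cong[where f="M.prob"])
  moreover have "\<P>(\<omega> in N. Y \<omega> \<in> B) = \<P>(\<omega> in N. k < Y \<omega> \<and> Y \<omega> \<in> B) + \<P>(\<omega> in N. Y \<omega> \<le> k \<and> Y \<omega> \<in> B)"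
    by (subst N.finite_measure_Union[symmetric]) (auto intro!: arg_cong[where f="N.prob"])
  moreover have "\<P>(\<omega> in M. X \<omega> \<le> k \<and> X \<omega> \<in> B) \<le> \<P>(\<omega> in M. X \<omega> \<le> k)"
    by (intro M.finite_measure_mono) auto
  moreover have "\<P>(\<omega> in N. Y \<omega> \<le> k \<and> Y \<omega> \<in> B) \<le> \<P>(\<omega> in N. Y \<omega> \<le> k)"
    by (intro N.finite_measure_mono) auto
  moreover have "0 \<le> \<P>(\<omega> in M. X \<omega> \<le> k \<and> X \<omega> \<in> B)" "0 \<le> \<P>(\<omega> in N. Y \<omega> \<le> k \<and> Y \<omega> \<in> B)"
    by simp_all
  ultimately show ?thesis using upper by linarith
qed

section \<open>The random function as a floor, and convergence in total variation\<close>

text \<open>The first logarithm is \<open>1 - log (1 / a) (H \<omega>)\<close>; writing the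
  fractional part as its argument minus the floor cancels the logarithm of H.\<close>

lemma rand_F_eq:
  assumes a: "0 < a" "a < 1" and H: "0 < H \<omega>" and t: "0 < t"
  shows "rand_F a H (log (1 / a) t) \<omega> =
    real_of_int (1 + \<lfloor>log (1 / a) (t / H \<omega>)\<rfloor>) - log (1 / a) t"
proof -
  have r: "0 < 1 / a" "1 / a \<noteq> 1" using a by auto
  have "log (1 / a) (1 / (a * H \<omega>)) = log (1 / a) ((1 / a) / H \<omega>)"
    by simp
  also have "\<dots> = 1 - log (1 / a) (H \<omega>)"
    using r H a by (subst log_divide) auto
  finally have 1: "log (1 / a) (1 / (a * H \<omega>)) = 1 - log (1 / a) (H \<omega>)" .
  have 2: "log (1 / a) (t / H \<omega>) = log (1 / a) t - log (1 / a) (H \<omega>)"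
    using r H t by (simp add: log_divide)
  show ?thesis
    unfolding rand_F_def 1 2 frac_def by simp
qed

text \<open>The summand 1 turns the strict inequality into
  \<open>real n \<le> log (1 / a) (t / x)\<close>, and the base exceeds 1. Thus tails of the floor
  variable become values of the distribution function of H.\<close>

lemma floor_log_ge_iff:
  assumes a: "0 < a" "a < 1" and x: "0 < x" and t: "0 < t"
  shows "int n < 1 + \<lfloor>log (1 / a) (t / x)\<rfloor> \<longleftrightarrow> x \<le> a ^ n * t"
proof -
  have "int n < 1 + \<lfloor>log (1 / a) (t / x)\<rfloor> \<longleftrightarrow> real n \<le> log (1 / a) (t / x)"
    by linarith
  also have "\<dots> \<longleftrightarrow> (1 / a) powr real n \<le> t / x"
    using a x t by (subst le_log_iff) auto
  also have "\<dots> \<longleftrightarrow> x \<le> a ^ n * t"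
    using a x by (simp add: powr_realpow field_simps)
  finally show ?thesis .
qed

lemma tv_dist_bounds:
  assumes "\<And>A. A \<in> sets P \<Longrightarrow> \<bar>measure P A - measure Q A\<bar> \<le> C"
  shows "0 \<le> tv_dist P Q" "tv_dist P Q \<le> C"
proof -
  \<comment> \<open>A real supremum can be compared with its members only if the set is bounded
    above; the empty set is then the member that gives nonnegativity.\<close>
  have "bdd_above ((\<lambda>A. \<bar>measure P A - measure Q A\<bar>) ` sets P)"
    using assms by (intro bdd_aboveI2) auto
  from cSUP_upper[OF sets.empty_sets this] show "0 \<le> tv_dist P Q"
    by (simp add: tv_dist_def)
  show "tv_dist P Q \<le> C"
    unfolding tv_dist_def using assms by (intro cSUP_least) auto
qed

theorem mainTheorem6:
  fixes a :: real
    and M :: "'w measure" and L :: "nat \<Rightarrow> 'w \<Rightarrow> nat"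
    and N :: "'v measure" and E :: "nat \<Rightarrow> 'v \<Rightarrow> real" and H :: "'v \<Rightarrow> real"
    and F :: "real \<Rightarrow> 'v \<Rightarrow> real"
  assumes a: "a \<in> {0<..<1}"
    and M: "prob_space M"
    and L: "markov_chain M {1..} (counter_kernel a) L"
    and L0: "AE \<omega> in M. L 0 \<omega> = 1"
    and N: "prob_space N"
    and E_indep: "prob_space.indep_vars N (\<lambda>_. borel) E UNIV"
    and E_exp: "\<And>k. distributed N lborel (E k) (exponential_density 1)"
    and H: "H = exp_series a E"
    and F: "F = rand_F a H"
  shows "asymp_equiv_laws
           (\<lambda>t. distr M borel (\<lambda>\<omega>. real (L t \<omega>) - log (1 / a) (real t)))
           (\<lambda>t. distr N borel (F (log (1 / a) (real t))))
         \<and> periodic_fun_simple F 1"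
proof
  have "frac (x + 1 - y) = frac (x - y)" for x y :: real
    using frac_1_eq[of "x - y"] by (simp add: algebra_simps)
  then show "periodic_fun_simple F 1"
    by unfold_locales (simp add: F rand_F_def fun_eq_iff)
next
  interpret M: prob_space M by fact
  interpret N: prob_space N by fact
  have a01: "0 < a" "a < 1" using a by auto
  have LS: "L t \<in> measurable M (count_space {1..})" for t
    using L by (simp add: markov_chain_def)
  have [measurable]: "L t \<in> measurable M (count_space UNIV)" for t
    using measurable_compose[OF LS[of t], of "\<lambda>x. x" "count_space UNIV"] by simp
  have "E k \<in> borel_measurable N" for k
    using E_exp[of k] distributed_measurable by fastforce
  then have Hm[measurable]: "H \<in> borel_measurable N"
    unfolding H by (rule exp_series_measurable)
  have Fm[measurable]: "F x \<in> borel_measurable N" for x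
    unfolding F rand_F_def frac_def by measurable
  have Hpos: "AE \<omega> in N. 0 < H \<omega>"
    unfolding H by (rule exp_series_AE_pos[OF a01 N E_exp])

  define p where "p t n = \<P>(\<omega> in M. n < L t \<omega>)" for t n
  have p0: "p t 0 = 1" for t
    unfolding p_def
    using measurable_space[OF LS[of t]] by (subst M.prob_Collect_eq_1) (auto intro!: AE_I2 simp: Suc_le_eq)
  have pinit: "p 0 (Suc n) = 0" for n
    unfolding p_def using L0 by (intro M.prob_eq_0_AE) auto
  define c where "c n = real (n + 1) * a ^ n * (H_mean a + 2)" for n
  have c: "\<bar>p t n - H_cdf a (a ^ n * real t)\<bar> \<le> c n" for t n
    unfolding c_def
    using tail_recursion_error[of a p, OF a01 p0 pinit] counter_tail_recursion[OF _ _ M L] a01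
    by (auto simp: p_def)
  have csum: "summable c"
    using sums_summable[OF geometric_deriv_sums[of a]] a01
    unfolding c_def by (intro summable_mult2) (simp add: add.commute)
  \<comment> \<open>\<open>X t\<close> and \<open>Y t\<close> are the two variables of the theorem
    with the common translation by \<open>log (1 / a) (real t)\<close> undone, the second one almost
    surely and for positive \<open>t\<close>.\<close>
  define X where "X t \<omega> = int (L t \<omega>)" for t \<omega>
  define Y where "Y t \<omega> = 1 + \<lfloor>log (1 / a) (real t / H \<omega>)\<rfloor>" for t \<omega>
  have [measurable]: "X t \<in> measurable M (count_space UNIV)" for t
    unfolding X_def by measurable
  have [measurable]: "Y t \<in> measurable N (count_space UNIV)" for t
    unfolding Y_def by measurable
  have Xp: "\<P>(\<omega> in M. int n < X t \<omega>) = p t n" for n t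
    by (simp add: X_def p_def)
  have Yq: "\<P>(\<omega> in N. int n < Y t \<omega>) = H_cdf a (a ^ n * real t)" if "0 < t" for n t
  proof -
    have "\<P>(\<omega> in N. int n < Y t \<omega>) = \<P>(\<omega> in N. H \<omega> \<le> a ^ n * real t)"
    proof (rule N.prob_eq_AE)
      show "AE \<omega> in N. int n < Y t \<omega> \<longleftrightarrow> H \<omega> \<le> a ^ n * real t"
        using Hpos that floor_log_ge_iff[OF a01, of _ "real t" n]
        by (auto simp: Y_def elim!: eventually_mono)
    qed measurable
    then show ?thesis
      unfolding H prob_exp_series_le[OF N E_indep E_exp] .
  qed
  let ?P = "\<lambda>t. distr M borel (\<lambda>\<omega>. real (L t \<omega>) - log (1 / a) (real t))"
  let ?Q = "\<lambda>t. distr N borel (F (log (1 / a) (real t)))"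
  \<comment> \<open>The masses up to \<open>k\<close> are \<open>1 - p t k\<close> and
    \<open>1 - H_cdf a (a ^ k * real t)\<close>. Replacing the former by the latter costs
    \<open>c k\<close>, which explains the factor 2 and the separate term
    \<open>c k\<close>.\<close>
  have bound: "\<bar>measure (?P t) A - measure (?Q t) A\<bar>
      \<le> 2 * (1 - H_cdf a (a ^ k * real t)) + (c k + 2 * (\<Sum>i. c (i + k)))"
    if t: "0 < t" and A: "A \<in> sets borel" for t k A
  proof -
    \<comment> \<open>The integers that land in \<open>A\<close> after the translation.\<close>
    let ?B = "{z. real_of_int z - log (1 / a) (real t) \<in> A}"
    have "measure (?P t) A = \<P>(\<omega> in M. X t \<omega> \<in> ?B)"
      using A by (subst measure_distr) (auto simp: X_def intro!: arg_cong[where f="M.prob"])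
    moreover have "measure (?Q t) A = \<P>(\<omega> in N. F (log (1 / a) (real t)) \<omega> \<in> A)"
      using A by (subst measure_distr) (auto intro!: arg_cong[where f="N.prob"])
    moreover have "\<dots> = \<P>(\<omega> in N. Y t \<omega> \<in> ?B)"
    proof (rule N.prob_eq_AE)
      show "AE \<omega> in N. F (log (1 / a) (real t)) \<omega> \<in> A \<longleftrightarrow> Y t \<omega> \<in> ?B"
        using Hpos t rand_F_eq[OF a01, of H _ "real t"]
        by (auto simp: Y_def F elim!: eventually_mono)
      show "{\<omega> \<in> space N. F (log (1 / a) (real t)) \<omega> \<in> A} \<in> N.events"
        using measurable_sets[OF Fm A] by (simp add: vimage_def Int_def conj_commute)
      have "Y t \<in> measurable N (count_space UNIV)" by measurable
      from measurable_sets[OF this, of ?B] show "{\<omega> \<in> space N. Y t \<omega> \<in> ?B} \<in> N.events"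
        by (simp add: vimage_def Int_def conj_commute)
    qed
    moreover have "\<bar>\<P>(\<omega> in M. X t \<omega> \<in> ?B) - \<P>(\<omega> in N. Y t \<omega> \<in> ?B)\<bar>
      \<le> \<P>(\<omega> in M. X t \<omega> \<le> int k) + \<P>(\<omega> in N. Y t \<omega> \<le> int k) + 2 * (\<Sum>i. c (i + k))"
    proof (rule int_laws_diff_le[OF M _ N])
      show "summable (\<lambda>i. c (i + k))"
        using csum by (subst summable_iff_shift)
      show "\<bar>\<P>(\<omega> in M. int k + int i < X t \<omega>) - \<P>(\<omega> in N. int k + int i < Y t \<omega>)\<bar> \<le> c (i + k)" for i
        using c[of t "i + k"] Xp[of "i + k" t] Yq[OF t, of "i + k"] by (simp add: add.commute)
    qed measurable
    moreover have "\<P>(\<omega> in M. X t \<omega> \<le> int k) = 1 - p t k"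
      unfolding Xp[symmetric] by (subst M.prob_neg[symmetric]) (auto simp: not_less)
    moreover have "\<P>(\<omega> in N. Y t \<omega> \<le> int k) = 1 - H_cdf a (a ^ k * real t)"
      unfolding Yq[OF t, symmetric] by (subst N.prob_neg[symmetric]) (auto simp: not_less)
    ultimately have "\<bar>measure (?P t) A - measure (?Q t) A\<bar>
      \<le> (1 - p t k) + (1 - H_cdf a (a ^ k * real t)) + 2 * (\<Sum>i. c (i + k))"
      by (simp only:)
    also have "\<dots> \<le> 2 * (1 - H_cdf a (a ^ k * real t)) + (c k + 2 * (\<Sum>i. c (i + k)))"
      using c[of t k] by (simp add: abs_le_iff algebra_simps)
    finally show ?thesis .
  qed
  have "(\<lambda>k. c k + 2 * (\<Sum>i. c (i + k))) \<longlonglongrightarrow> 0 + 2 * 0"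
    using csum by (intro tendsto_add tendsto_mult tendsto_const summable_LIMSEQ_zero suminf_exist_split2)
  then have clim: "(\<lambda>k. c k + 2 * (\<Sum>i. c (i + k))) \<longlonglongrightarrow> 0" by simp
  show "asymp_equiv_laws ?P ?Q"
    unfolding asymp_equiv_laws_def
  proof (rule LIMSEQ_I)
    fix e :: real assume e: "0 < e"
    \<comment> \<open>First \<open>k\<close> is fixed so that the part independent of
      \<open>t\<close> is below \<open>e / 2\<close>; then \<open>t\<close> is taken large for this
      \<open>k\<close>, and twice \<open>e / 4\<close> accounts for the other half.\<close>
    from order_tendstoD(2)[OF clim, of "e / 2"] e obtain k where
      k: "c k + 2 * (\<Sum>i. c (i + k)) < e / 2"
      by (auto simp: eventually_sequentially)
    have "(\<lambda>t. H_cdf a (a ^ k * real t)) \<longlonglongrightarrow> 1"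
      using a01 by (intro H_cdf_tendsto) auto
    from order_tendstoD(1)[OF this, of "1 - e / 4"] e obtain T where
      T: "\<And>t. T \<le> t \<Longrightarrow> 1 - e / 4 < H_cdf a (a ^ k * real t)"
      by (auto simp: eventually_sequentially)
    \<comment> \<open>Starting from \<open>Suc T\<close> ensures \<open>0 < t\<close>, as
      \<open>bound\<close> requires.\<close>
    have "norm (tv_dist (?P t) (?Q t) - 0) < e" if "Suc T \<le> t" for t
    proof -
      have "0 < t" using that by simp
      note tv = tv_dist_bounds[of "?P t" "?Q t", OF bound[OF this, of _ k]]
      have "0 \<le> tv_dist (?P t) (?Q t)" by (rule tv(1)) simp
      moreover have "tv_dist (?P t) (?Q t) \<le> 2 * (1 - H_cdf a (a ^ k * real t)) + (c k + 2 * (\<Sum>i. c (i + k)))"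
        by (rule tv(2)) simp
      ultimately show ?thesis
        using T[of t] k that by simp
    qed
    then show "\<exists>T. \<forall>t\<ge>T. norm (tv_dist (?P t) (?Q t) - 0) < e" by blast
  qed
qed

end
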